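(* Let $\mathcal{H}$ be a complex Hilbert space, let $A\in\mathcal{B}(\mathcal{H})$ be positive (semi-definite), let $\mathbb{A}=\begin{pmatrix}A&0\\0&A\end{pmatrix}$, and let $\mathbb{T}=\begin{pmatrix}P&Q\\R&S\end{pmatrix}$ with $P,Q,R,S\in\mathcal{B}_{A}(\mathcal{H})$. Then $$\omega_{\mathbb{A}}(\mathbb{T})\le\sqrt{\omega_A^2(P)+\frac12\|Q\|_A\left(\omega_A(P)+\frac12\|Q\|_A\right)}+\sqrt{\omega_A^2(S)+\frac12\|R\|_A\left(\omega_A(S)+\frac12\|R\|_A\right)}.$$
   Context: $\mathcal{B}(\mathcal{H})$ is the algebra of bounded linear operators on $\mathcal{H}$. The positive semi-definite operator $A$ induces the semi-inner product $\langle x\mid y\rangle_A=\langle Ax\mid y\rangle$ and the seminorm $\|x\|_A=\langle x\mid x\rangle_A^{1/2}=\|A^{1/2}x\|$. An operator $T\in\mathcal{B}(\mathcal{H})$ is $A$-bounded if there is $\lambda>0$ with $\|Tx\|_A\le\lambda\|x\|_A$ for all $x\in\mathcal{H}$; then $\|T\|_A=\sup\{\|Tx\|_A : x\in\mathcal{H},\ \|x\|_A=1\}$. The $A$-numerical radius is $\omega_A(T)=\sup\{|\langle Tx\mid x\rangle_A| : x\in\mathcal{H},\ \|x\|_A=1\}$, and $\omega_A^2(T)$ means $(\omega_A(T))^2$. $\mathcal{B}_A(\mathcal{H})$ is the set of $T\in\mathcal{B}(\mathcal{H})$ with $\mathcal{R}(T^*A)\subseteq\mathcal{R}(A)$ ($\mathcal{R}$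 denotes range), equivalently those admitting an $A$-adjoint, i.e. a bounded $X$ with $AX=T^*A$; all such $T$ are $A$-bounded. The operator $\mathbb{A}$ is a positive operator on $\mathcal{H}\oplus\mathcal{H}$, with $\langle x,y\rangle_{\mathbb{A}}=\langle x_1\mid y_1\rangle_A+\langle x_2\mid y_2\rangle_A$ for $x=(x_1,x_2)$, $y=(y_1,y_2)$; $\|\cdot\|_{\mathbb{A}}$ and $\omega_{\mathbb{A}}$ are defined in the same way with $(\mathcal{H}\oplus\mathcal{H},\mathbb{A})$ in place of $(\mathcal{H},A)$. A $2\times2$ matrix of operators on $\mathcal{H}$ denotes the corresponding operator on $\mathcal{H}\oplus\mathcal{H}$. *)

theory Defs
  imports "HOL-Analysis.Analysis"
begin

text \<open>
  Complex inner product spaces. The real inner product, norm and topology of \<open>real_inner\<close> are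
  tied to the complex structure by \<open>scaleR_scaleC\<close> and \<open>inner_cinner\<close>, so that in particular
  \<open>(norm x)\<^sup>2 = Re (cinner x x)\<close>. The inner product is linear in its first argument.
\<close>

class complex_inner = real_inner +
  fixes scaleC :: "complex \<Rightarrow> 'a \<Rightarrow> 'a" (infixr "*\<^sub>C" 75)
    and cinner :: "'a \<Rightarrow> 'a \<Rightarrow> complex"
  assumes scaleC_add_right: "c *\<^sub>C (x + y) = c *\<^sub>C x + c *\<^sub>C y"
    and scaleC_add_left: "(c + d) *\<^sub>C x = c *\<^sub>C x + d *\<^sub>C x"
    and scaleC_scaleC: "c *\<^sub>C d *\<^sub>C x = (c * d) *\<^sub>C x"
    and scaleR_scaleC: "r *\<^sub>R x = complex_of_real r *\<^sub>C x"
    and cinner_commute: "cinner x y = cnj (cinner y x)"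
    and cinner_add_left: "cinner (x + y) z = cinner x z + cinner y z"
    and cinner_scaleC_left: "cinner (c *\<^sub>C x) y = c * cinner x y"
    and inner_cinner: "inner x y = Re (cinner x y)"

class complex_hilbert_space = complex_inner + complete_space

instantiation complex :: complex_hilbert_space
begin

definition scaleC_complex :: "complex \<Rightarrow> complex \<Rightarrow> complex"
  where "scaleC_complex c x = c * x"

definition cinner_complex :: "complex \<Rightarrow> complex \<Rightarrow> complex"
  where "cinner_complex x y = x * cnj y"

instance
  by standard
    (simp_all add: scaleC_complex_def cinner_complex_def inner_complex_def algebra_simps
      scaleR_conv_of_real)

end

text \<open>The orthogonal direct sum of two Hilbert spaces.\<close>

instantiation prod :: (complex_inner, complex_inner) complex_inner
begin

definition scaleC_prod :: "complex \<Rightarrow> 'a \<times> 'b \<Rightarrow> 'a \<times> 'b"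
  where "scaleC_prod c x = (c *\<^sub>C fst x, c *\<^sub>C snd x)"

definition cinner_prod :: "'a \<times> 'b \<Rightarrow> 'a \<times> 'b \<Rightarrow> complex"
  where "cinner_prod x y = cinner (fst x) (fst y) + cinner (snd x) (snd y)"

instance
proof
  fix x y :: "'a \<times> 'b"
  show "cinner x y = cnj (cinner y x)"
    unfolding cinner_prod_def complex_cnj_add
    using cinner_commute[of "fst x" "fst y"] cinner_commute[of "snd x" "snd y"] by simp
qed (simp_all add: scaleC_prod_def cinner_prod_def scaleR_prod_def inner_prod_def
      scaleC_add_right scaleC_add_left scaleC_scaleC scaleR_scaleC cinner_add_left
      cinner_scaleC_left inner_cinner algebra_simps)

end

instance prod :: (complex_hilbert_space, complex_hilbert_space) complex_hilbert_space ..

definition bounded_clinear :: "('a::complex_inner \<Rightarrow> 'b::complex_inner) \<Rightarrow> bool"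
  where "bounded_clinear T \<longleftrightarrow> bounded_linear T \<and> (\<forall>c x. T (c *\<^sub>C x) = c *\<^sub>C T x)"

definition positive_op :: "('a::complex_inner \<Rightarrow> 'a) \<Rightarrow> bool"
  where "positive_op A \<longleftrightarrow>
    bounded_clinear A \<and> (\<forall>x. cinner (A x) x \<in> \<real> \<and> 0 \<le> Re (cinner (A x) x))"

text \<open>The Hilbert space adjoint; it exists, and is unique, for bounded operators.\<close>

definition cadjoint :: "('a::complex_hilbert_space \<Rightarrow> 'b::complex_hilbert_space) \<Rightarrow> 'b \<Rightarrow> 'a"
  where "cadjoint T = (THE S. \<forall>x y. cinner (T x) y = cinner x (S y))"

definition A_inner :: "('a::complex_inner \<Rightarrow> 'a) \<Rightarrow> 'a \<Rightarrow> 'a \<Rightarrow> complex"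
  where "A_inner A x y = cinner (A x) y"

definition A_norm :: "('a::complex_inner \<Rightarrow> 'a) \<Rightarrow> 'a \<Rightarrow> real"
  where "A_norm A x = sqrt (Re (A_inner A x x))"

text \<open>
  The suprema below are suprema of subsets of \<open>[0, \<infinity>)\<close>: inserting \<open>0\<close> has no effect unless
  there is no \<open>x\<close> with \<open>A_norm A x = 1\<close> (that is, unless \<open>A = 0\<close>), in which case the supremum
  is \<open>0\<close>. The sets are bounded above whenever \<open>T\<close> is \<open>A\<close>-bounded, in particular for \<open>T\<close> in
  \<open>A_adjointable A\<close>; otherwise \<open>Sup\<close> has no meaning.
\<close>

definition A_op_norm :: "('a::complex_inner \<Rightarrow> 'a) \<Rightarrow> ('a \<Rightarrow> 'a) \<Rightarrow> real"
  where "A_op_norm A T = Sup (insert 0 {A_norm A (T x) |x. A_norm A x = 1})"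

definition A_numerical_radius :: "('a::complex_inner \<Rightarrow> 'a) \<Rightarrow> ('a \<Rightarrow> 'a) \<Rightarrow> real"
  where "A_numerical_radius A T =
    Sup (insert 0 {cmod (A_inner A (T x) x) |x. A_norm A x = 1})"

text \<open>
  By Douglas' theorem the range condition says that \<open>T\<close> admits an \<open>A\<close>-adjoint, i.e. a bounded
  \<open>X\<close> with \<open>A \<circ> X = cadjoint T \<circ> A\<close>.
\<close>

definition A_adjointable :: "('a::complex_hilbert_space \<Rightarrow> 'a) \<Rightarrow> ('a \<Rightarrow> 'a) set"
  where "A_adjointable A = {T. bounded_clinear T \<and> range (cadjoint T \<circ> A) \<subseteq> range A}"

definition op_matrix ::
    "('a \<Rightarrow> 'a) \<Rightarrow> ('a \<Rightarrow> 'a) \<Rightarrow> ('a \<Rightarrow> 'a) \<Rightarrow> ('a \<Rightarrow> 'a) \<Rightarrow> 'a \<times> 'a \<Rightarrow> 'a::complex_inner \<times> 'a"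
  where "op_matrix P Q R S x = (P (fst x) + Q (snd x), R (fst x) + S (snd x))"

end

theory Submission
  imports Defs
begin

text \<open>
  A unit vector \<open>(x, y)\<close> of the direct sum has \<open>a\<^sup>2 + b\<^sup>2 = 1\<close> for its two seminorms
  \<open>a = A_norm A x\<close> and \<open>b = A_norm A y\<close>, and the quadratic form of the block operator at \<open>(x, y)\<close>
  is the sum of one contribution for each row. The first row contributes
  \<open>\<langle>P x, x\<rangle> + \<langle>Q y, x\<rangle>\<close> (semi-inner products with respect to \<open>A\<close>), of modulus at most
  \<open>p a\<^sup>2 + q a b\<close>, where \<open>p\<close> is the numerical radius of \<open>P\<close> and \<open>q\<close> the seminorm of \<open>Q\<close>. The
  maximum of this form on the unit circle is the larger eigenvalue \<open>(p + sqrt (p\<^sup>2 + q\<^sup>2)) / 2\<close> of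
  its symmetric matrix, and \<open>sqrt (p\<^sup>2 + q\<^sup>2) \<le> p + q\<close> shows that the square of this eigenvalue
  is at most \<open>p\<^sup>2 + q/2 * (p + q/2)\<close>. The second row is symmetric
  (\<open>quadratic_form_on_unit_circle_le\<close>, \<open>op_matrix_row_bound\<close>).

  The estimates \<open>|\<langle>P x, x\<rangle>| \<le> p a\<^sup>2\<close> and \<open>A_norm A (Q y) \<le> q b\<close> need the suprema that define
  \<open>p\<close> and \<open>q\<close> to be taken over bounded sets, and they must also hold at vectors of seminorm zero,
  which no rescaling turns into unit vectors. Both follow once operators in \<open>A_adjointable A\<close> are
  known to be \<open>A\<close>-bounded (\<open>A_adjointable_A_bounded\<close>), and this is where the analysis lies.
  The range condition gives, for each \<open>y\<close>, some \<open>z\<close> with \<open>\<langle>A T x, y\<rangle> = \<langle>A x, z\<rangle>\<close> for all \<open>x\<close>;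
  the Riesz representation theorem is what makes \<open>cadjoint\<close> an actual adjoint here. By Baire
  category this pointwise information becomes the uniform estimate
  \<open>norm (A (T x)) \<le> M * norm (A x)\<close>. Passing from \<open>A\<close> to its square root is done with the moments
  \<open>\<langle>A s\<^sup>n x, x\<rangle>\<close> of a map \<open>s\<close> satisfying \<open>A s = T\<^sup>* A T\<close>: they form a log-convex sequence of at
  most geometric growth, so already the first ratio
  \<open>\<langle>A T x, T x\<rangle> / \<langle>A x, x\<rangle>\<close> is bounded by the growth rate, independently of \<open>x\<close>.
\<close>

section \<open>Riesz representation and uniform boundedness in Hilbert spaces\<close>

text \<open>
  The representing vector is the minimiser of \<open>J y = (norm y)\<^sup>2 - 2 * f y\<close>, which equals
  \<open>(norm (y - z))\<^sup>2 - (norm z)\<^sup>2\<close> when \<open>z\<close> represents \<open>f\<close>. The parallelogram identity makes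
  every minimising sequence a Cauchy sequence, and the first variation of \<open>J\<close> at its limit vanishes.
\<close>

lemma riesz_representation:
  fixes f :: "'a::{real_inner,complete_space} \<Rightarrow> real"
  assumes "bounded_linear f"
  shows "\<exists>y. \<forall>x. f x = inner x y"
proof -
  interpret f: bounded_linear f by fact
  define J where "J y = (norm y)\<^sup>2 - 2 * f y" for y
  obtain K where K: "norm (f x) \<le> norm x * K" for x
    using f.bounded by blast
  have J_lower: "J y \<ge> - K\<^sup>2" for y
  proof -
    have "f y \<le> norm y * K" using K[of y] by simp
    moreover have "0 \<le> (norm y - K)\<^sup>2" by simp
    ultimately show ?thesis by (simp add: J_def power2_diff)
  qed
  then have bdd: "bdd_below (range J)" unfolding bdd_below_def by blast
  define m where "m = Inf (range J)"
  have m_le: "m \<le> J y" for y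
    unfolding m_def by (rule cInf_lower[OF _ bdd]) simp
  have "\<exists>y. J y < m + 1 / real (Suc n)" for n
    using cInf_lessD[of "range J" "m + 1 / real (Suc n)"] by (auto simp: m_def)
  then obtain y where y: "J (y n) < m + 1 / real (Suc n)" for n by metis
  have par: "(norm (u - v))\<^sup>2 = 2 * J u + 2 * J v - 4 * J ((1/2) *\<^sub>R (u + v))" for u v
    unfolding J_def f.scaleR f.add power2_norm_eq_inner
    by (simp add: inner_simps inner_commute[of v u] algebra_simps)
  have small: "(norm (y k - y l))\<^sup>2 < 2 / real (Suc k) + 2 / real (Suc l)" for k l
    using par[of "y k" "y l"] y[of k] y[of l] m_le[of "(1/2) *\<^sub>R (y k + y l)"] by simp
  have "Cauchy y"
  proof (rule metric_CauchyI)
    fix e :: real assume e: "e > 0"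
    obtain N where N: "1 / real (Suc N) < e\<^sup>2 / 4"
      using nat_approx_posE[of "e\<^sup>2/4"] e by (metis zero_less_divide_iff zero_less_numeral zero_less_power)
    have "dist (y k) (y l) < e" if "k \<ge> N" "l \<ge> N" for k l
    proof -
      have "1 / real (Suc k) \<le> 1 / real (Suc N)" "1 / real (Suc l) \<le> 1 / real (Suc N)"
        using that by (simp_all add: frac_le)
      then have "(norm (y k - y l))\<^sup>2 < e\<^sup>2" using small[of k l] N by simp
      then show ?thesis using e by (simp add: dist_norm power_less_imp_less_base)
    qed
    then show "\<exists>N. \<forall>k\<ge>N. \<forall>l\<ge>N. dist (y k) (y l) < e" by blast
  qed
  then obtain z where z: "y \<longlonglongrightarrow> z" using Cauchy_convergent convergent_def by metis
  have "(\<lambda>n. J (y n)) \<longlonglongrightarrow> J z"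
    unfolding J_def by (intro tendsto_intros f.tendsto z)
  moreover have "(\<lambda>n. m + 1 / real (Suc n)) \<longlonglongrightarrow> m + 0"
    by (intro tendsto_intros LIMSEQ_Suc[OF lim_1_over_n])
  ultimately have "J z \<le> m + 0"
    using y by (intro LIMSEQ_le) (auto intro: less_imp_le)
  then have min: "J z \<le> J v" for v using m_le[of v] by simp
  have "f x = inner x z" for x
  proof (rule ccontr)
    assume ne: "f x \<noteq> inner x z"
    define c where "c = f x - inner x z"
    have c: "c \<noteq> 0" using ne by (simp add: c_def)
    have x: "x \<noteq> 0" using ne f.zero by auto
    have "J (z + t *\<^sub>R x) = J z - 2 * t * c + t\<^sup>2 * (norm x)\<^sup>2" for t
      unfolding J_def f.scaleR f.add power2_norm_eq_inner c_def
      by (simp add: inner_simps inner_commute[of z x] algebra_simps power2_eq_square)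
    \<comment> \<open>This step length minimises the quadratic polynomial in \<open>t\<close>.\<close>
    from this[of "c / (norm x)\<^sup>2"] have "J (z + (c / (norm x)\<^sup>2) *\<^sub>R x) = J z - c\<^sup>2 / (norm x)\<^sup>2"
      using x by (simp add: field_simps power2_eq_square)
    moreover have "c\<^sup>2 / (norm x)\<^sup>2 > 0" using c x by simp
    ultimately show False using min[of "z + (c / (norm x)\<^sup>2) *\<^sub>R x"] by linarith
  qed
  then show ?thesis by blast
qed

text \<open>
  The uniform boundedness principle. Every point lies in one of the closed sets \<open>G n\<close> on which all
  \<open>v \<in> V\<close> are bounded by \<open>n\<close>, so by Baire some \<open>G n\<close> contains a ball; moving from its centre by
  its radius in the direction of \<open>v\<close> measures the norm of \<open>v\<close>.
\<close>

lemma weakly_bounded_imp_bounded: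
  fixes V :: "'a::{real_inner,complete_space} set"
  assumes "\<And>y. \<exists>B. \<forall>v\<in>V. \<bar>inner v y\<bar> \<le> B"
  shows "\<exists>M. \<forall>v\<in>V. norm v \<le> M"
proof -
  define G where "G n = {y. \<forall>v\<in>V. \<bar>inner v y\<bar> \<le> real n}" for n
  have closed: "closed (G n)" for n
    unfolding G_def Collect_ball_eq by (intro closed_INT ballI closed_Collect_le continuous_intros)
  have cover: "(\<Union>n. G n) = UNIV"
  proof -
    have "\<exists>n. y \<in> G n" for y
    proof -
      obtain B where "\<forall>v\<in>V. \<bar>inner v y\<bar> \<le> B" using assms by blast
      moreover obtain n where "B \<le> real n" using real_arch_simple by blast
      ultimately show ?thesis unfolding G_def using order_trans by blast
    qed
    then show ?thesis by blast
  qed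
  have "\<exists>n. interior (G n) \<noteq> {}"
  proof (rule ccontr)
    assume "\<not> ?thesis"
    then have "euclidean interior_of \<Union>(range G) = {}"
      using closed completely_metrizable_space_euclidean by (intro Baire_category_alt) auto
    then show False by (simp add: cover)
  qed
  then obtain n w where "w \<in> interior (G n)" by blast
  then obtain e where e: "e > 0" "cball w e \<subseteq> G n" by (auto simp: mem_interior_cball)
  have "norm v \<le> 2 * real n / e" if v: "v \<in> V" for v
  proof (cases "v = 0")
    case True
    then show ?thesis using e by simp
  next
    case False
    define u where "u = w + (e / norm v) *\<^sub>R v"
    have "u \<in> G n" "w \<in> G n"
      using e False by (auto simp: u_def dist_norm intro!: subsetD[OF e(2)])
    then have "\<bar>inner v u\<bar> \<le> n" "\<bar>inner v w\<bar> \<le> n" using v by (auto simp: G_def)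
    moreover have "inner v u = inner v w + e * norm v"
      using False by (simp add: u_def inner_simps power2_norm_eq_inner[symmetric] power2_eq_square)
    ultimately have "norm v * e \<le> 2 * real n" by (simp add: mult.commute)
    then show ?thesis using e by (simp add: pos_le_divide_eq)
  qed
  then show ?thesis by blast
qed

section \<open>Two inequalities for real numbers\<close>

text \<open>
  Log-convexity says that the ratios \<open>h (Suc n) / h n\<close> increase. If the first of them exceeded \<open>K\<close>,
  then \<open>h\<close> would grow faster than \<open>C * K ^ n\<close>.
\<close>

lemma log_convex_first_ratio_le:
  fixes h :: "nat \<Rightarrow> real"
  assumes nonneg: "\<And>n. 0 \<le> h n"
    and convex: "\<And>n. (h (Suc n))\<^sup>2 \<le> h n * h (Suc (Suc n))"
    and geometric: "\<And>n. h n \<le> C * K ^ n" and K: "0 \<le> K"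
  shows "h 1 \<le> K * h 0"
proof (cases "h 0 = 0 \<or> h 1 = 0")
  case True
  then have "h 1 = 0" using convex[of 0] by auto
  then show ?thesis using K nonneg[of 0] by simp
next
  case False
  then have pos: "h 0 > 0" "h 1 > 0" using nonneg[of 0] nonneg[of 1] by auto
  define r where "r = h 1 / h 0"
  have r: "r > 0" using pos by (simp add: r_def)
  have step: "h n > 0 \<and> r * h n \<le> h (Suc n)" for n
  proof (induction n)
    case 0
    then show ?case using pos by (simp add: r_def)
  next
    case (Suc n)
    then have n: "h n > 0" "r * h n \<le> h (Suc n)" by auto
    have S: "h (Suc n) > 0" using n r by (meson less_le_trans mult_pos_pos)
    have "h n * (r * h (Suc n)) \<le> h (Suc n) * h (Suc n)"
      using mult_right_mono[OF n(2), of "h (Suc n)"] S by (simp add: mult_ac)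
    also have "\<dots> \<le> h n * h (Suc (Suc n))" using convex[of n] by (simp add: power2_eq_square)
    finally show ?case using n S by simp
  qed
  have lower: "h 0 * r ^ n \<le> h n" for n
  proof (induction n)
    case (Suc n)
    have "h 0 * r ^ Suc n \<le> r * h n" using Suc r by (simp add: mult_ac)
    then show ?case using step[of n] by linarith
  qed simp
  have "r \<le> K"
  proof (rule ccontr)
    assume "\<not> r \<le> K"
    then have q: "0 \<le> K / r" "K / r < 1" using K r by simp_all
    have "h 0 \<le> C * (K / r) ^ n" for n
      using order_trans[OF lower geometric, of n] r by (simp add: power_divide pos_le_divide_eq)
    moreover have "(\<lambda>n. C * (K / r) ^ n) \<longlonglongrightarrow> C * 0"
      using q by (intro tendsto_intros LIMSEQ_power_zero) auto
    ultimately have "h 0 \<le> C * 0" by (intro LIMSEQ_le_const) auto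
    then show False using pos by simp
  qed
  then show ?thesis using pos by (simp add: r_def pos_divide_le_eq)
qed

text \<open>
  In terms of the double angle, with cosine \<open>a\<^sup>2 - b\<^sup>2\<close> and sine \<open>2 * a * b\<close>, the left-hand side is
  \<open>p/2\<close> plus half the inner product of \<open>(p, q)\<close> with a unit vector, hence at most
  \<open>(p + sqrt (p\<^sup>2 + q\<^sup>2)) / 2\<close>.
\<close>

lemma quadratic_form_on_unit_circle_le:
  fixes a b p q :: real
  assumes p: "0 \<le> p" and q: "0 \<le> q" and unit: "a\<^sup>2 + b\<^sup>2 = 1"
  shows "p * a\<^sup>2 + q * (a * b) \<le> sqrt (p\<^sup>2 + 1/2 * q * (p + 1/2 * q))"
proof -
  define s where "s = sqrt (p\<^sup>2 + q\<^sup>2)"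
  have s: "s \<ge> 0" "s\<^sup>2 = p\<^sup>2 + q\<^sup>2" "s \<le> p + q"
    using p q by (auto simp: s_def intro: sqrt_sum_squares_le_sum)
  have circle: "(a\<^sup>2 - b\<^sup>2)\<^sup>2 + (2 * a * b)\<^sup>2 = 1"
    using arg_cong[OF unit, of "\<lambda>t. t\<^sup>2"] by (simp add: power2_eq_square algebra_simps)
  have "(p * (a\<^sup>2 - b\<^sup>2) + q * (2 * a * b))\<^sup>2 + (p * (2 * a * b) - q * (a\<^sup>2 - b\<^sup>2))\<^sup>2
      = (p\<^sup>2 + q\<^sup>2) * ((a\<^sup>2 - b\<^sup>2)\<^sup>2 + (2 * a * b)\<^sup>2)"
    by algebra
  \<comment> \<open>Cauchy--Schwarz in the plane, obtained from the Lagrange identity just proved.\<close>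
  then have "(p * (a\<^sup>2 - b\<^sup>2) + q * (2 * a * b))\<^sup>2 \<le> s\<^sup>2"
    using circle s(2) by (smt (verit) mult_cancel_left1 zero_le_power2)
  then have "p * (a\<^sup>2 - b\<^sup>2) + q * (2 * a * b) \<le> s"
    using s(1) power2_le_imp_le by blast
  moreover have "b\<^sup>2 = 1 - a\<^sup>2" using unit by simp
  ultimately have le: "p * a\<^sup>2 + q * (a * b) \<le> (p + s) / 2"
    by (simp add: algebra_simps)
  have "p * s \<le> p * (p + q)" using s p by (simp add: mult_left_mono)
  then have "((p + s) / 2)\<^sup>2 \<le> p\<^sup>2 + 1/2 * q * (p + 1/2 * q)"
    using s(2) by (simp add: power2_eq_square algebra_simps)
  then show ?thesis using le real_le_rsqrt order_trans by blast
qed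

section \<open>Complex inner products and the adjoint\<close>

lemma cinner_add_right: "cinner x (y + z) = cinner x y + cinner x z"
  using cinner_commute[of x "y + z"] cinner_commute[of x y] cinner_commute[of x z]
  by (simp add: cinner_add_left)

lemma cinner_scaleC_right: "cinner x (c *\<^sub>C y) = cnj c * cinner x y"
  using cinner_commute[of x "c *\<^sub>C y"] cinner_commute[of x y]
  by (simp add: cinner_scaleC_left)

text \<open>
  The real inner product determines the complex one. A complex linear identity can therefore be
  checked on real parts alone, which is how the remaining arguments come down to real inner products.
\<close>

lemma cinner_eq_inner:
  "cinner x y = Complex (inner x y) (- inner (\<i> *\<^sub>C x) y)"
  by (simp add: inner_cinner cinner_scaleC_left complex_eq_iff)

text \<open>
  Riesz representation provides a map with the defining property of the adjoint, and that property
  has only one solution, so the definite description in \<open>cadjoint\<close> denotes it.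
\<close>

lemma cadjoint_inner:
  fixes T :: "'a::complex_hilbert_space \<Rightarrow> 'b::complex_hilbert_space"
  assumes T: "bounded_clinear T"
  shows "inner (T x) y = inner x (cadjoint T y)"
proof -
  have "bounded_linear T" and TC: "T (c *\<^sub>C x) = c *\<^sub>C T x" for c x
    using T by (auto simp: bounded_clinear_def)
  then have "\<exists>z. \<forall>x. inner (T x) y = inner x z" for y
    by (intro riesz_representation bounded_linear_inner_left_comp)
  then obtain S where S: "inner (T x) y = inner x (S y)" for x y by metis
  have "cinner (T x) y = cinner x (S y)" for x y
    using S[of x y] S[of "\<i> *\<^sub>C x" y] by (simp add: cinner_eq_inner TC)
  moreover have "S' = S" if "\<forall>x y. cinner (T x) y = cinner x (S' y)" for S'
  proof
    fix y
    have "inner x (S' y - S y) = 0" for x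
      using that S[of x y] by (simp add: inner_diff_right) (simp add: inner_cinner)
    from this[of "S' y - S y"] show "S' y = S y" by simp
  qed
  ultimately have "cadjoint T = S" unfolding cadjoint_def by (intro the_equality) blast+
  then show ?thesis using S by simp
qed

section \<open>The semi-inner product of a positive operator\<close>

lemma positive_op_bounded_linear: "positive_op A \<Longrightarrow> bounded_linear A"
  and positive_op_scaleC: "positive_op A \<Longrightarrow> A (c *\<^sub>C x) = c *\<^sub>C A x"
  and positive_op_inner_nonneg: "positive_op A \<Longrightarrow> 0 \<le> inner (A x) x"
  by (auto simp: positive_op_def bounded_clinear_def inner_cinner)

text \<open>
  Over the complex numbers a real quadratic form forces symmetry: realness at
  \<open>x + \<i> *\<^sub>C y\<close>, together with realness at \<open>x\<close> and \<open>y\<close>, equates the real parts of the two mixed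
  terms.
\<close>

lemma positive_op_symmetric:
  assumes A: "positive_op A"
  shows "inner (A x) y = inner x (A y)"
proof -
  interpret A: bounded_linear A using A by (rule positive_op_bounded_linear)
  have real: "Im (cinner (A u) u) = 0" for u
    using A by (auto simp: positive_op_def complex_is_Real_iff)
  have "Im (cinner (A (x + \<i> *\<^sub>C y)) (x + \<i> *\<^sub>C y)) = 0" by (rule real)
  then have "Re (cinner (A x) y) = Re (cinner (A y) x)"
    using real[of x] real[of y]
    by (simp add: A.add positive_op_scaleC[OF A] cinner_add_left cinner_add_right
        cinner_scaleC_left cinner_scaleC_right)
  then show ?thesis by (simp add: inner_cinner[symmetric] inner_commute)
qed

text \<open>
  The quadratic polynomial \<open>t \<mapsto> \<langle>A (x - t y), x - t y\<rangle>\<close> is nonnegative, so its discriminant is not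
  positive. Since \<open>A\<close> may have a kernel, the polynomial can degenerate to an affine function, which
  must then be constant.
\<close>

lemma A_Cauchy_Schwarz_square:
  assumes A: "positive_op A"
  shows "(inner (A x) y)\<^sup>2 \<le> inner (A x) x * inner (A y) y"
proof -
  interpret A: bounded_linear A using A by (rule positive_op_bounded_linear)
  define a b c where abc: "a = inner (A x) x" "b = inner (A x) y" "c = inner (A y) y"
  have nonneg: "0 \<le> a" "0 \<le> c" using positive_op_inner_nonneg[OF A] by (auto simp: abc)
  have sym: "inner (A y) x = b"
    using positive_op_symmetric[OF A, of y x] by (simp add: abc inner_commute)
  have quad: "0 \<le> a - 2 * t * b + t\<^sup>2 * c" for t
    using positive_op_inner_nonneg[OF A, of "x - t *\<^sub>R y"] sym
    by (simp add: A.diff A.scaleR inner_simps abc power2_eq_square algebra_simps)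
  have "b\<^sup>2 \<le> a * c"
  proof (cases "c = 0")
    case True
    have "b = 0"
    proof (rule ccontr)
      assume "b \<noteq> 0"
      then show False using quad[of "(a + 1) / (2 * b)"] True by simp
    qed
    then show ?thesis using True by simp
  next
    case False
    then have "0 \<le> a - b\<^sup>2 / c" using quad[of "b / c"] by (simp add: field_simps power2_eq_square)
    then show ?thesis using False nonneg by (simp add: field_simps)
  qed
  then show ?thesis by (simp add: abc)
qed

lemma A_norm_power2: "positive_op A \<Longrightarrow> (A_norm A x)\<^sup>2 = inner (A x) x"
  by (simp add: A_norm_def A_inner_def inner_cinner[symmetric] positive_op_inner_nonneg)

lemma A_norm_nonneg: "positive_op A \<Longrightarrow> 0 \<le> A_norm A x"
  by (simp add: A_norm_def A_inner_def inner_cinner[symmetric] positive_op_inner_nonneg)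

lemma A_norm_scaleC:
  assumes A: "positive_op A"
  shows "A_norm A (c *\<^sub>C x) = cmod c * A_norm A x"
proof -
  have "inner (A (c *\<^sub>C x)) (c *\<^sub>C x) = Re (c * cnj c * cinner (A x) x)"
    by (simp add: inner_cinner positive_op_scaleC[OF A] cinner_scaleC_left cinner_scaleC_right mult_ac)
  also have "\<dots> = (cmod c)\<^sup>2 * inner (A x) x"
    by (simp add: complex_norm_square[symmetric] inner_cinner flip: of_real_power)
  finally have "(A_norm A (c *\<^sub>C x))\<^sup>2 = (cmod c * A_norm A x)\<^sup>2"
    by (simp add: A_norm_power2[OF A] power_mult_distrib)
  then show ?thesis using A_norm_nonneg[OF A] by (simp add: power2_eq_iff_nonneg)
qed

lemma A_norm_scaleR: "positive_op A \<Longrightarrow> A_norm A (r *\<^sub>R x) = \<bar>r\<bar> * A_norm A x"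
  by (simp add: scaleR_scaleC A_norm_scaleC)

text \<open>
  Multiplying \<open>x\<close> by a unimodular scalar makes the complex semi-inner product real and nonnegative
  without changing seminorms, so the real inequality applies.
\<close>

lemma A_Cauchy_Schwarz:
  assumes A: "positive_op A"
  shows "cmod (A_inner A x y) \<le> A_norm A x * A_norm A y"
proof -
  define z where "z = cinner (A x) y"
  obtain c where c: "cmod c = 1" "c * z = of_real (cmod z)"
  proof (cases "z = 0")
    case False
    have "cmod (cnj z / of_real (cmod z)) = 1" using False by (simp add: norm_divide)
    moreover have "cnj z / of_real (cmod z) * z = of_real (cmod z)"
      using False complex_norm_square[of z] by (simp add: field_simps power2_eq_square)
    ultimately show ?thesis using that by blast
  qed (use that[of 1] in simp)
  have "cmod z = Re (c * z)" using c by simp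
  also have "\<dots> = inner (A (c *\<^sub>C x)) y"
    by (simp add: z_def inner_cinner positive_op_scaleC[OF A] cinner_scaleC_left)
  finally have eq: "cmod z = inner (A (c *\<^sub>C x)) y" .
  have "(cmod z)\<^sup>2 \<le> (A_norm A (c *\<^sub>C x) * A_norm A y)\<^sup>2"
    using A_Cauchy_Schwarz_square[OF A, of "c *\<^sub>C x" y]
    by (simp add: eq power_mult_distrib A_norm_power2[OF A])
  then show ?thesis
    using c(1) A_norm_nonneg[OF A]
    by (auto simp: z_def A_inner_def A_norm_scaleC[OF A] intro: power2_le_imp_le)
qed

section \<open>Adjointable operators are bounded in the seminorm\<close>

lemma A_adjointable_bounded_linear: "T \<in> A_adjointable A \<Longrightarrow> bounded_linear T"
  by (simp add: A_adjointable_def bounded_clinear_def)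

text \<open>
  The only form in which the range condition is used: \<open>z\<close> is a preimage under \<open>A\<close> of
  \<open>cadjoint T (A y)\<close>.
\<close>

lemma A_adjointable_pointwise_adjoint:
  assumes A: "positive_op A" and T: "T \<in> A_adjointable A"
  shows "\<exists>z. \<forall>x. inner (A (T x)) y = inner (A x) z"
proof -
  obtain z where z: "cadjoint T (A y) = A z"
    using T by (force simp: A_adjointable_def)
  have "inner (A (T x)) y = inner (A x) z" for x
  proof -
    have "inner (A (T x)) y = inner x (cadjoint T (A y))"
      using T by (simp add: A_adjointable_def cadjoint_inner positive_op_symmetric[OF A])
    then show ?thesis by (simp add: z positive_op_symmetric[OF A])
  qed
  then show ?thesis by blast
qed

text \<open>
  The vectors \<open>A (T x)\<close> with \<open>norm (A x) \<le> 1\<close> form a weakly bounded set, because the pointwise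
  adjoint bounds their inner products with \<open>y\<close> by \<open>norm z\<close>.
\<close>

lemma A_adjointable_range_bound:
  assumes A: "positive_op A" and T: "T \<in> A_adjointable A"
  shows "\<exists>M\<ge>0. \<forall>x. norm (A (T x)) \<le> M * norm (A x)"
proof -
  interpret A: bounded_linear A using A by (rule positive_op_bounded_linear)
  interpret T: bounded_linear T using T by (rule A_adjointable_bounded_linear)
  have "\<exists>B. \<forall>v\<in>{A (T x) |x. norm (A x) \<le> 1}. \<bar>inner v y\<bar> \<le> B" for y
  proof -
    obtain z where z: "inner (A (T x)) y = inner (A x) z" for x
      using A_adjointable_pointwise_adjoint[OF A T] by blast
    have "\<bar>inner (A (T x)) y\<bar> \<le> norm z" if "norm (A x) \<le> 1" for x
      using Cauchy_Schwarz_ineq2[of "A x" z] mult_right_mono[OF that, of "norm z"]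
      by (simp add: z)
    then show ?thesis by auto
  qed
  then obtain M where M: "norm (A (T x)) \<le> M" if "norm (A x) \<le> 1" for x
    using weakly_bounded_imp_bounded[of "{A (T x) |x. norm (A x) \<le> 1}"] by blast
  have "norm (A (T x)) \<le> M * norm (A x)" for x
  proof (cases "A x = 0")
    case True
    obtain z where "inner (A (T x)) (A (T x)) = inner (A x) z"
      using A_adjointable_pointwise_adjoint[OF A T] by blast
    then show ?thesis using True by simp
  next
    case False
    then show ?thesis
      using M[of "(1 / norm (A x)) *\<^sub>R x"] by (simp add: A.scaleR T.scaleR pos_divide_le_eq)
  qed
  moreover have "0 \<le> M" using M[of 0] norm_ge_zero order_trans by (metis A.zero norm_zero zero_le_one)
  ultimately show ?thesis by blast
qed

text \<open>
  Let \<open>s u\<close> be a pointwise adjoint vector for \<open>T u\<close>, so that \<open>A s = T\<^sup>* A T\<close>. Although \<open>s\<close> is an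
  arbitrary choice, it is symmetric for the semi-inner product, so powers of \<open>s\<close> can be moved
  between the two arguments of the moments \<open>h n = \<langle>A s\<^sup>n x, x\<rangle>\<close>. Even moments are squared
  seminorms of the iterates \<open>s\<^sup>k x\<close> and odd ones of \<open>T s\<^sup>k x\<close>, so Cauchy--Schwarz yields
  log-convexity. The estimate between the norms of \<open>A (T x)\<close> and \<open>A x\<close> yields geometric growth
  at a rate independent of \<open>x\<close>.
\<close>

theorem A_adjointable_A_bounded:
  assumes A: "positive_op A" and T: "T \<in> A_adjointable A"
  shows "\<exists>K. \<forall>x. A_norm A (T x) \<le> K * A_norm A x"
proof -
  obtain M where M: "M \<ge> 0" "norm (A (T x)) \<le> M * norm (A x)" for x
    using A_adjointable_range_bound[OF A T] by blast
  obtain L where L: "L > 0" "norm (T x) \<le> norm x * L" for x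
    using bounded_linear.pos_bounded[OF A_adjointable_bounded_linear[OF T]] by blast
  have "\<forall>u. \<exists>v. \<forall>w. inner (A (T w)) (T u) = inner (A w) v"
    using A_adjointable_pointwise_adjoint[OF A T] by blast
  then obtain s where s: "inner (A (T w)) (T u) = inner (A w) (s u)" for u w
    by metis
  have swap: "inner (A (s u)) w = inner (A u) (s w)" for u w
    by (metis s inner_commute positive_op_symmetric[OF A])
  have growth: "norm (A (s u)) \<le> L * M * norm (A u)" for u
  proof (cases "A (s u) = 0")
    case False
    \<comment> \<open>Testing against \<open>A (s u)\<close> itself moves one factor \<open>A\<close> onto \<open>T u\<close>.\<close>
    let ?w = "A (s u)"
    have "norm ?w * norm ?w = inner (T ?w) (A (T u))"
      using s[of ?w u] by (simp add: positive_op_symmetric[OF A]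
          power2_norm_eq_inner[symmetric] power2_eq_square)
    also have "\<dots> \<le> norm (T ?w) * norm (A (T u))" by (rule norm_cauchy_schwarz)
    also have "\<dots> \<le> (norm ?w * L) * (M * norm (A u))"
      using L M by (intro mult_mono) auto
    finally have "norm ?w * norm ?w \<le> norm ?w * (L * M * norm (A u))" by (simp add: mult_ac)
    then show ?thesis using False by simp
  qed (use L M in simp)
  have key: "inner (A (T x)) (T x) \<le> L * M * inner (A x) x" for x
  proof -
    define h where "h n = inner (A ((s ^^ n) x)) x" for n
    have shift: "inner (A ((s ^^ (n + m)) x)) x = inner (A ((s ^^ n) x)) ((s ^^ m) x)" for n m
    proof (induction m arbitrary: n)
      case (Suc m)
      then show ?case using Suc[of "Suc n"] by (simp add: swap)
    qed simp
    have even: "h (2 * k) = inner (A ((s ^^ k) x)) ((s ^^ k) x)" for k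
      using shift[of k k] by (simp add: h_def mult_2)
    have odd: "h (Suc (2 * k)) = inner (A (T ((s ^^ k) x))) (T ((s ^^ k) x))" for k
      using shift[of k "Suc k"] by (simp add: h_def mult_2 s)
    have even': "h (Suc (Suc (2 * k))) = inner (A (T ((s ^^ k) x))) (T ((s ^^ Suc k) x))" for k
      using even[of "Suc k"] by (simp add: s swap)
    have odd': "h (Suc (2 * k)) = inner (A ((s ^^ k) x)) ((s ^^ Suc k) x)" for k
      using odd by (simp add: s)
    have parity: "thesis" if "\<And>k. n = 2 * k \<Longrightarrow> thesis"
      "\<And>k. n = Suc (2 * k) \<Longrightarrow> thesis" for n :: nat and thesis
      using that by (metis evenE oddE Suc_eq_plus1)
    have "h 1 \<le> (L * M) * h 0"
    proof (rule log_convex_first_ratio_le)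
      show "0 \<le> h n" for n
        by (rule parity[of n]) (simp_all add: even odd positive_op_inner_nonneg[OF A])
      show "(h (Suc n))\<^sup>2 \<le> h n * h (Suc (Suc n))" for n
      proof (rule parity[of n])
        fix k assume n: "n = 2 * k"
        show ?thesis using A_Cauchy_Schwarz_square[OF A, of "(s ^^ k) x" "(s ^^ Suc k) x"]
          even[of k] even[of "Suc k"] odd'[of k] by (simp add: n)
      next
        fix k assume n: "n = Suc (2 * k)"
        show ?thesis using A_Cauchy_Schwarz_square[OF A, of "T ((s ^^ k) x)" "T ((s ^^ Suc k) x)"]
          odd[of k] odd[of "Suc k"] even'[of k] by (simp add: n)
      qed
      have "norm (A ((s ^^ n) x)) \<le> (L * M) ^ n * norm (A x)" for n
      proof (induction n)
        case (Suc n)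
        have "norm (A ((s ^^ Suc n) x)) \<le> (L * M) * norm (A ((s ^^ n) x))"
          using growth by simp
        also have "\<dots> \<le> (L * M) * ((L * M) ^ n * norm (A x))"
          using Suc L M by (intro mult_left_mono) auto
        finally show ?case by (simp add: mult_ac)
      qed simp
      then show "h n \<le> (norm (A x) * norm x) * (L * M) ^ n" for n
        unfolding h_def
        using norm_cauchy_schwarz[of "A ((s ^^ n) x)" x] mult_right_mono[of _ _ "norm x"]
        by (smt (verit) mult.assoc mult.commute norm_ge_zero)
      show "0 \<le> L * M" using L M by simp
    qed
    then show ?thesis using odd[of 0] by (simp add: h_def)
  qed
  have "A_norm A (T x) \<le> sqrt (L * M) * A_norm A x" for x
  proof -
    have "(A_norm A (T x))\<^sup>2 \<le> (sqrt (L * M) * A_norm A x)\<^sup>2"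
      using key[of x] L M by (simp add: power_mult_distrib A_norm_power2[OF A])
    then show ?thesis
      using L M A_norm_nonneg[OF A] by (auto intro: power2_le_imp_le)
  qed
  then show ?thesis by blast
qed

section \<open>Seminorm and numerical radius as homogeneous bounds\<close>

text \<open>
  The bounds extend from unit vectors by homogeneity. Where the seminorm of \<open>x\<close> vanishes this is
  impossible, and \<open>A\<close>-boundedness is used again to see that the left-hand side vanishes too.
\<close>

lemma A_op_norm_bound:
  assumes A: "positive_op A" and T: "T \<in> A_adjointable A"
  shows "0 \<le> A_op_norm A T" and "A_norm A (T x) \<le> A_op_norm A T * A_norm A x"
proof -
  interpret T: bounded_linear T using T by (rule A_adjointable_bounded_linear)
  obtain K where K: "A_norm A (T x) \<le> K * A_norm A x" for x
    using A_adjointable_A_bounded[OF A T] by blast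
  let ?V = "insert 0 {A_norm A (T x) |x. A_norm A x = 1}"
  have bdd: "bdd_above ?V"
  proof (rule bdd_aboveI[of _ "\<bar>K\<bar>"])
    fix v assume "v \<in> ?V"
    then consider "v = 0" | u where "v = A_norm A (T u)" "A_norm A u = 1" by blast
    then show "v \<le> \<bar>K\<bar>"
    proof cases
      case 2
      then show ?thesis using K[of u] by simp
    qed simp
  qed
  show "0 \<le> A_op_norm A T" unfolding A_op_norm_def by (rule cSup_upper[OF _ bdd]) simp
  have unit: "A_norm A (T u) \<le> A_op_norm A T" if "A_norm A u = 1" for u
    unfolding A_op_norm_def using that by (intro cSup_upper[OF _ bdd]) auto
  show "A_norm A (T x) \<le> A_op_norm A T * A_norm A x"
  proof (cases "A_norm A x = 0")
    case True
    then show ?thesis using K[of x] by simp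
  next
    case False
    then show ?thesis
      using unit[of "(1 / A_norm A x) *\<^sub>R x"] A_norm_nonneg[OF A, of x]
      by (simp add: A_norm_scaleR[OF A] T.scaleR pos_divide_le_eq)
  qed
qed

lemma A_numerical_radius_bound:
  assumes A: "positive_op A" and T: "T \<in> A_adjointable A"
  shows "0 \<le> A_numerical_radius A T"
    and "cmod (A_inner A (T x) x) \<le> A_numerical_radius A T * (A_norm A x)\<^sup>2"
proof -
  interpret A: bounded_linear A using A by (rule positive_op_bounded_linear)
  interpret T: bounded_linear T using T by (rule A_adjointable_bounded_linear)
  let ?V = "insert 0 {cmod (A_inner A (T x) x) |x. A_norm A x = 1}"
  have bdd: "bdd_above ?V"
  proof (rule bdd_aboveI[of _ "A_op_norm A T"])
    fix v assume "v \<in> ?V"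
    then consider "v = 0" | u where "v = cmod (A_inner A (T u) u)" "A_norm A u = 1" by blast
    then show "v \<le> A_op_norm A T"
    proof cases
      case 2
      then show ?thesis
        using A_Cauchy_Schwarz[OF A, of "T u" u] A_op_norm_bound(2)[OF A T, of u] by simp
    qed (simp add: A_op_norm_bound(1)[OF A T])
  qed
  show "0 \<le> A_numerical_radius A T"
    unfolding A_numerical_radius_def by (rule cSup_upper[OF _ bdd]) simp
  have unit: "cmod (A_inner A (T u) u) \<le> A_numerical_radius A T" if "A_norm A u = 1" for u
    unfolding A_numerical_radius_def using that by (intro cSup_upper[OF _ bdd]) auto
  show "cmod (A_inner A (T x) x) \<le> A_numerical_radius A T * (A_norm A x)\<^sup>2"
  proof (cases "A_norm A x = 0")
    case True
    then show ?thesis using A_Cauchy_Schwarz[OF A, of "T x" x] by simp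
  next
    case False
    define r where "r = 1 / A_norm A x"
    have r: "r > 0" "r * A_norm A x = 1" using False A_norm_nonneg[OF A, of x] by (simp_all add: r_def)
    have "A_inner A (T (r *\<^sub>R x)) (r *\<^sub>R x) = of_real (r\<^sup>2) * A_inner A (T x) x"
      unfolding A_inner_def A.scaleR T.scaleR
      by (simp add: scaleR_scaleC cinner_scaleC_left cinner_scaleC_right power2_eq_square)
    then have "r\<^sup>2 * cmod (A_inner A (T x) x) \<le> A_numerical_radius A T"
      using unit[of "r *\<^sub>R x"] r by (simp add: A_norm_scaleR[OF A] norm_mult norm_power)
    then show ?thesis using False by (simp add: r_def field_simps)
  qed
qed

section \<open>The numerical radius of a block operator\<close>

text \<open>
  One row of the block operator, with diagonal entry \<open>T\<close> and off-diagonal entry \<open>U\<close>. Naming the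
  entries by their position lets the same bound serve both rows, with \<open>x\<close> and \<open>y\<close> exchanged for the
  second.
\<close>

lemma op_matrix_row_bound:
  assumes A: "positive_op A" and T: "T \<in> A_adjointable A" and U: "U \<in> A_adjointable A"
    and unit: "(A_norm A x)\<^sup>2 + (A_norm A y)\<^sup>2 = 1"
  shows "cmod (A_inner A (T x) x + A_inner A (U y) x)
    \<le> sqrt ((A_numerical_radius A T)\<^sup>2
        + 1/2 * A_op_norm A U * (A_numerical_radius A T + 1/2 * A_op_norm A U))"
proof -
  have "cmod (A_inner A (U y) x) \<le> A_norm A (U y) * A_norm A x"
    by (rule A_Cauchy_Schwarz[OF A])
  also have "\<dots> \<le> (A_op_norm A U * A_norm A y) * A_norm A x"
    by (intro mult_right_mono A_op_norm_bound[OF A U] A_norm_nonneg[OF A])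
  finally have "cmod (A_inner A (T x) x + A_inner A (U y) x)
      \<le> A_numerical_radius A T * (A_norm A x)\<^sup>2 + A_op_norm A U * (A_norm A x * A_norm A y)"
    using A_numerical_radius_bound(2)[OF A T, of x]
    by (intro order_trans[OF norm_triangle_ineq]) (simp add: mult_ac)
  also note quadratic_form_on_unit_circle_le
    [OF A_numerical_radius_bound(1)[OF A T] A_op_norm_bound(1)[OF A U] unit]
  finally show ?thesis .
qed

theorem theorem2p4:
  fixes A P Q R S :: "'a::complex_hilbert_space \<Rightarrow> 'a"
  assumes "positive_op A"
    and "P \<in> A_adjointable A" and "Q \<in> A_adjointable A"
    and "R \<in> A_adjointable A" and "S \<in> A_adjointable A"
  shows "A_numerical_radius (op_matrix A (\<lambda>_. 0) (\<lambda>_. 0) A) (op_matrix P Q R S)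
    \<le> sqrt ((A_numerical_radius A P)\<^sup>2
          + 1/2 * A_op_norm A Q * (A_numerical_radius A P + 1/2 * A_op_norm A Q))
      + sqrt ((A_numerical_radius A S)\<^sup>2
          + 1/2 * A_op_norm A R * (A_numerical_radius A S + 1/2 * A_op_norm A R))"
    (is "_ \<le> ?b1 + ?b2")
proof -
  let ?AA = "op_matrix A (\<lambda>_. 0) (\<lambda>_. 0) A" and ?TT = "op_matrix P Q R S"
  interpret A: bounded_linear A using assms(1) by (rule positive_op_bounded_linear)
  have "0 \<le> ?b1 + ?b2"
    using assms by (intro add_nonneg_nonneg real_sqrt_ge_zero mult_nonneg_nonneg)
      (simp_all add: A_numerical_radius_bound A_op_norm_bound)
  moreover have "cmod (A_inner ?AA (?TT w) w) \<le> ?b1 + ?b2" if w: "A_norm ?AA w = 1" for w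
  proof -
    obtain x y where xy: "w = (x, y)" by fastforce
    have unit: "(A_norm A x)\<^sup>2 + (A_norm A y)\<^sup>2 = 1"
      using w A_norm_power2[OF assms(1)]
      by (simp add: A_norm_def[of ?AA] A_inner_def op_matrix_def cinner_prod_def xy inner_cinner)
    have "cmod (A_inner A (P x) x + A_inner A (Q y) x) \<le> ?b1"
      using assms unit by (intro op_matrix_row_bound)
    moreover have "cmod (A_inner A (S y) y + A_inner A (R x) y) \<le> ?b2"
      using assms unit by (intro op_matrix_row_bound) (simp_all add: add.commute)
    moreover have "A_inner ?AA (?TT w) w
        = (A_inner A (P x) x + A_inner A (Q y) x) + (A_inner A (S y) y + A_inner A (R x) y)"
      by (simp add: A_inner_def op_matrix_def cinner_prod_def xy A.add cinner_add_left)
    ultimately show ?thesis by (metis norm_triangle_mono)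
  qed
  ultimately show ?thesis
    unfolding A_numerical_radius_def[of ?AA] by (intro cSup_least) auto
qed

end
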